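(* Let $p(x,y)$ be a polynomial and $k$ a non-negative integer. There exist a finite set $S$ of permutations and real coefficients $\gamma_\sigma$, $\sigma\in S$, such that \[\int_{[0,1]^2} p(x,y)F_{\mu}^k(x,y)\,\mathrm{d}\mu=\sum_{\sigma\in S}\gamma_\sigma d(\sigma,\mu)\] for every permuton $\mu$.
   Context: A permuton is a probability measure $\mu$ on the Borel sets of $[0,1]^2$ with uniform marginals, i.e., $\mu([\alpha,\beta]\times[0,1])=\mu([0,1]\times[\alpha,\beta])=\beta-\alpha$ for all $0\le\alpha\le\beta\le1$. A $\mu$-random permutation of order $n$ is obtained by sampling $n$ points $(x_1,y_1),\dots,(x_n,y_n)$ independently according to $\mu$ (almost surely all $x$-coordinates are distinct and all $y$-coordinates are distinct), ordering them so that $x_{i_1}<\dots<x_{i_n}$, and letting $\pi$ be the permutation of $[n]$ with $\pi(j)<\pi(j')$ iff $y_{i_j}<y_{i_{j'}}$. For a permutation $\sigma$ of order $n$, $d(\sigma,\mu)$ is the probability that a $\mu$-random permutation of order $n$ equals $\sigma$. $F_\mu(x,y)=\mu([0,x]\times[0,y])$. *)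

theory Defs
  imports
    "HOL-Probability.Probability"
    "HOL-Computational_Algebra.Polynomial"
    "HOL-Combinatorics.Permutations"
begin

abbreviation unit_square :: "(real \<times> real) set" where
  "unit_square \<equiv> {0..1} \<times> {0..1}"

definition permuton :: "(real \<times> real) measure \<Rightarrow> bool" where
  "permuton \<mu> \<longleftrightarrow>
     prob_space \<mu> \<and> sets \<mu> = sets (restrict_space borel unit_square) \<and>
     (\<forall>\<alpha> \<beta>. 0 \<le> \<alpha> \<and> \<alpha> \<le> \<beta> \<and> \<beta> \<le> 1 \<longrightarrow>
        measure \<mu> ({\<alpha>..\<beta>} \<times> {0..1}) = \<beta> - \<alpha> \<and>
        measure \<mu> ({0..1} \<times> {\<alpha>..\<beta>}) = \<beta> - \<alpha>)"

definition permuton_cdf :: "(real \<times> real) measure \<Rightarrow> real \<Rightarrow> real \<Rightarrow> real" where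
  "permuton_cdf \<mu> x y = measure \<mu> ({0..x} \<times> {0..y})"

(* A permutation of order n is a function permuting {1..n} (hence the identity elsewhere),
   tagged with its order n, since the function alone does not determine it. *)
definition perms :: "(nat \<times> (nat \<Rightarrow> nat)) set" where
  "perms = {(n, \<sigma>). n \<ge> 1 \<and> \<sigma> permutes {1..n}}"

(* \<pi> is the permutation read off the points z 1, ..., z n; the witness i lists the points
   by increasing x-coordinate.  If two of the points share a coordinate, no \<pi> qualifies. *)
definition is_pattern :: "nat \<Rightarrow> (nat \<Rightarrow> real \<times> real) \<Rightarrow> (nat \<Rightarrow> nat) \<Rightarrow> bool" where
  "is_pattern n z \<pi> \<longleftrightarrow>
     \<pi> permutes {1..n} \<and>
     (\<exists>i. i permutes {1..n} \<and>
        strict_mono_on {1..n} (\<lambda>j. fst (z (i j))) \<and>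
        (\<forall>j\<in>{1..n}. \<forall>j'\<in>{1..n}. \<pi> j < \<pi> j' \<longleftrightarrow> snd (z (i j)) < snd (z (i j'))))"

fun pattern_density :: "nat \<times> (nat \<Rightarrow> nat) \<Rightarrow> (real \<times> real) measure \<Rightarrow> real" where
  "pattern_density (n, \<sigma>) \<mu> =
     measure (PiM {1..n} (\<lambda>_. \<mu>))
       {z \<in> space (PiM {1..n} (\<lambda>_. \<mu>)). is_pattern n z \<sigma>}"

(* Real bivariate polynomials as polynomials in y with coefficients in \<real>[x]. *)
definition poly2 :: "real poly poly \<Rightarrow> real \<Rightarrow> real \<Rightarrow> real" where
  "poly2 p x y = poly (poly p [:y:]) x"

(* The event measured by pattern_density is measurable, so its measure is not a junk value. *)
lemma pattern_event_measurable:
  assumes "permuton \<mu>"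
  shows "{z \<in> space (PiM {1..n} (\<lambda>_. \<mu>)). is_pattern n z \<sigma>} \<in> sets (PiM {1..n} (\<lambda>_. \<mu>))"
proof -
  let ?P = "PiM {1..n} (\<lambda>_. \<mu>)"
  have meas: "fst \<in> borel_measurable \<mu>" "snd \<in> borel_measurable \<mu>"
    using assms measurable_cong_sets[of \<mu> "restrict_space borel unit_square" borel borel]
    by (auto simp: permuton_def borel_prod[symmetric] intro!: measurable_restrict_space1)
  have coord: "(\<lambda>z. fst (z k)) \<in> borel_measurable ?P" "(\<lambda>z. snd (z k)) \<in> borel_measurable ?P"
    if "k \<in> {1..n}" for k
    using that meas by (auto intro!: measurable_compose[OF measurable_component_singleton])
  have "{z \<in> space ?P. is_pattern n z \<sigma>} =
      (\<Union>i\<in>{i. i permutes {1..n} \<and> \<sigma> permutes {1..n}}. {z \<in> space ?P.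
         (\<forall>j\<in>{1..n}. \<forall>j'\<in>{1..n}. j < j' \<longrightarrow> fst (z (i j)) < fst (z (i j'))) \<and>
         (\<forall>j\<in>{1..n}. \<forall>j'\<in>{1..n}. \<sigma> j < \<sigma> j' \<longleftrightarrow> snd (z (i j)) < snd (z (i j')))})"
    by (auto simp: is_pattern_def strict_mono_on_def)
  also have "\<dots> \<in> sets ?P"
  proof (rule sets.finite_UN)
    show "finite {i. i permutes {1..n} \<and> \<sigma> permutes {1..n}}"
      using finite_permutations[of "{1..n}"] by (auto intro: finite_subset)
  next
    fix i assume "i \<in> {i. i permutes {1..n} \<and> \<sigma> permutes {1..n}}"
    then have "i j \<in> {1..n}" if "j \<in> {1..n}" for j
      using that permutes_in_image[of i "{1..n}" j] by simp
    then have m: "(\<lambda>z. fst (z (i j))) \<in> borel_measurable ?P"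
      "(\<lambda>z. snd (z (i j))) \<in> borel_measurable ?P" if "j \<in> {1..n}" for j
      using coord that by blast+
    have 1: "{z \<in> space ?P. j < j' \<longrightarrow> fst (z (i j)) < fst (z (i j'))} \<in> sets ?P"
      and 2: "{z \<in> space ?P. \<sigma> j < \<sigma> j' \<longleftrightarrow> snd (z (i j)) < snd (z (i j'))} \<in> sets ?P"
      if "j \<in> {1..n}" "j' \<in> {1..n}" for j j'
    proof -
      note [measurable] = m[OF that(1)] m[OF that(2)]
      show "{z \<in> space ?P. j < j' \<longrightarrow> fst (z (i j)) < fst (z (i j'))} \<in> sets ?P"
        "{z \<in> space ?P. \<sigma> j < \<sigma> j' \<longleftrightarrow> snd (z (i j)) < snd (z (i j'))} \<in> sets ?P"
        by measurable
    qed
    show "{z \<in> space ?P.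
         (\<forall>j\<in>{1..n}. \<forall>j'\<in>{1..n}. j < j' \<longrightarrow> fst (z (i j)) < fst (z (i j'))) \<and>
         (\<forall>j\<in>{1..n}. \<forall>j'\<in>{1..n}. \<sigma> j < \<sigma> j' \<longleftrightarrow> snd (z (i j)) < snd (z (i j')))} \<in> sets ?P"
      by (intro sets.sets_Collect_conj sets.sets_Collect_finite_All 1 2) auto
  qed
  finally show ?thesis .
qed

end

theory Submission
  imports Defs
begin

text \<open>
  By linearity it suffices to treat a monomial \<open>x\<^sup>a y\<^sup>b\<close>.  Since the marginals are uniform,
  \<open>x\<close>, \<open>y\<close> and \<open>F x y\<close> are the probabilities that a \<open>\<mu>\<close>-random point lies to the left of,
  below, and both to the left of and below \<open>(x, y)\<close>.  Hence \<open>\<integral> x\<^sup>a y\<^sup>b F\<^sup>k d\<mu>\<close> is the probability that,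
  among \<open>1 + a + k + b\<close> independent points, certain \<open>a + k\<close> points are to the left of the first
  one and certain \<open>k + b\<close> points are below it, the two groups sharing \<open>k\<close> points.  As the points are
  exchangeable, this probability does not change when the labels are averaged over all
  permutations, and after averaging it depends only on the pattern of the points.
\<close>

section \<open>Ranks of coordinates and the pattern of a point configuration\<close>

text \<open>\<open>r\<close> is the rank permutation of the values \<open>f 1\<close>, ...,
  \<open>f n\<close>. Since the order is required in both directions and \<open>r\<close> is
  injective, a tie of \<open>f\<close> on \<open>{1..n}\<close> excludes every
  \<open>r\<close>.\<close>

definition orders_as :: "nat \<Rightarrow> (nat \<Rightarrow> 'a::linorder) \<Rightarrow> (nat \<Rightarrow> nat) \<Rightarrow> bool" where
  "orders_as n f r \<longleftrightarrow>
     r permutes {1..n} \<and> (\<forall>j\<in>{1..n}. \<forall>j'\<in>{1..n}. r j < r j' \<longleftrightarrow> f j < f j')"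

text \<open>The permutation \<open>r\<close> carries the set being counted injectively onto
  \<open>{1..r j}\<close>. This determines \<open>r\<close> from \<open>f\<close> and supplies the
  formula for constructing it.\<close>

lemma orders_as_eq_card:
  assumes "orders_as n f r" "j \<in> {1..n}"
  shows "r j = card {l \<in> {1..n}. f l \<le> f j}"
proof -
  have le: "r j' \<le> r l \<longleftrightarrow> f j' \<le> f l"
    if "j' \<in> {1..n}" "l \<in> {1..n}" for j' l
    using assms that by (auto simp: orders_as_def not_less[symmetric])
  from assms have r: "r permutes {1..n}"
    by (simp add: orders_as_def)
  have "r ` {l \<in> {1..n}. f l \<le> f j} = r ` {l \<in> {1..n}. r l \<le> r j}"
    using le assms(2) by auto
  also have "\<dots> = r ` {1..n} \<inter> {..r j}"
    by auto
  also have "\<dots> = {1..n} \<inter> {..r j}"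
    unfolding permutes_image[OF r] ..
  also have "\<dots> = {1..r j}"
    using assms(2) permutes_in_image[OF r, of j] by auto
  finally have "card (r ` {l \<in> {1..n}. f l \<le> f j}) = r j"
    by simp
  moreover have "inj_on r {l \<in> {1..n}. f l \<le> f j}"
    using permutes_inj_on[OF r] .
  ultimately show ?thesis
    by (simp add: card_image)
qed

lemma orders_as_unique:
  assumes "orders_as n f r" "orders_as n f r'"
  shows "r = r'"
proof
  fix j show "r j = r' j"
  proof (cases "j \<in> {1..n}")
    case True
    with assms show ?thesis
      by (simp add: orders_as_eq_card)
  next
    case False
    moreover have "r permutes {1..n}" "r' permutes {1..n}"
      using assms by (simp_all add: orders_as_def)
    ultimately show ?thesis
      by (metis permutes_not_in)
  qed
qed

lemma orders_as_exists:
  assumes inj: "inj_on f {1..n}"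
  shows "\<exists>r. orders_as n f r"
proof -
  \<comment> \<open>This formula is forced by \<open>orders_as_eq_card\<close>; the identity off
    \<open>{1..n}\<close> is what \<open>permutes\<close> demands.\<close>
  define r where "r j = (if j \<in> {1..n} then card {l \<in> {1..n}. f l \<le> f j} else j)" for j
  have mono: "r j < r j'" if "j \<in> {1..n}" "j' \<in> {1..n}" "f j < f j'" for j j'
  proof -
    \<comment> \<open>The index \<open>j'\<close> itself makes the inclusion of the two counted sets
      strict.\<close>
    have "j' \<in> {l \<in> {1..n}. f l \<le> f j'} - {l \<in> {1..n}. f l \<le> f j}"
      using that by auto
    moreover have "{l \<in> {1..n}. f l \<le> f j} \<subseteq> {l \<in> {1..n}. f l \<le> f j'}"
      using that by auto
    ultimately have "{l \<in> {1..n}. f l \<le> f j} \<subset> {l \<in> {1..n}. f l \<le> f j'}"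
      by blast
    then show ?thesis
      using that by (simp add: r_def psubset_card_mono)
  qed
  \<comment> \<open>The converse of \<open>mono\<close> comes from trichotomy: the reversed order is
    excluded by \<open>mono\<close>, and a tie occurs only for \<open>j = j'\<close>.\<close>
  have less: "r j < r j' \<longleftrightarrow> f j < f j'" if "j \<in> {1..n}" "j' \<in> {1..n}" for j j'
    using mono[OF that] mono[OF that(2,1)] inj_onD[OF inj _ that]
    by (cases "f j" "f j'" rule: linorder_cases) auto
  have inj_r: "inj_on r {1..n}"
  proof (rule inj_onI)
    fix j j' assume j: "j \<in> {1..n}" "j' \<in> {1..n}" and "r j = r j'"
    then have "f j = f j'"
      using less[OF j] less[OF j(2,1)] by simp
    then show "j = j'"
      using inj_onD[OF inj] j by blast
  qed
  have "r j \<in> {1..n}" if "j \<in> {1..n}" for j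
  proof -
    have "card {l \<in> {1..n}. f l \<le> f j} \<le> card {1..n}"
      by (rule card_mono) auto
    moreover have "{l \<in> {1..n}. f l \<le> f j} \<noteq> {}"
      using that by auto
    then have "card {l \<in> {1..n}. f l \<le> f j} > 0"
      by (simp add: card_gt_0_iff)
    ultimately show ?thesis
      using that by (simp add: r_def)
  qed
  then have "r ` {1..n} = {1..n}"
    using inj_r by (intro endo_inj_surj) blast+
  then have "bij_betw r {1..n} {1..n}"
    using inj_r by (simp add: bij_betw_def)
  then have "r permutes {1..n}"
    by (rule bij_imp_permutes) (simp only: r_def if_False)
  with less show ?thesis
    by (auto simp: orders_as_def)
qed

text \<open>The witness \<open>i\<close> in \<open>is_pattern\<close> sends an x-rank to the label
  of a point, so its inverse \<open>r\<close> sends a label to its x-rank. The pattern turns x-ranks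
  into y-ranks, hence \<open>\<pi> \<circ> r\<close> ranks the y-coordinates. In this form the
  uniqueness and existence of ranks carry over to patterns.\<close>

lemma is_pattern_iff_orders_as:
  "is_pattern n z \<pi> \<longleftrightarrow>
     (\<exists>r. orders_as n (\<lambda>j. fst (z j)) r \<and> orders_as n (\<lambda>j. snd (z j)) (\<pi> \<circ> r))"
proof
  assume "is_pattern n z \<pi>"
  then obtain i where i: "i permutes {1..n}" and \<pi>: "\<pi> permutes {1..n}"
    and mono: "strict_mono_on {1..n} (\<lambda>j. fst (z (i j)))"
    and snd: "\<And>j j'. j \<in> {1..n} \<Longrightarrow> j' \<in> {1..n} \<Longrightarrow> \<pi> j < \<pi> j' \<longleftrightarrow> snd (z (i j)) < snd (z (i j'))"
    unfolding is_pattern_def by blast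
  have inv: "inv i permutes {1..n}" "\<And>j. i (inv i j) = j"
    using i by (auto simp: permutes_inv permutes_inverses)
  have "j \<in> {1..n} \<Longrightarrow> inv i j \<in> {1..n}" for j
    using permutes_in_image[OF inv(1)] by simp
  then have "inv i j < inv i j' \<longleftrightarrow> fst (z j) < fst (z j')"
    "\<pi> (inv i j) < \<pi> (inv i j') \<longleftrightarrow> snd (z j) < snd (z j')"
    if "j \<in> {1..n}" "j' \<in> {1..n}" for j j'
    using that snd[of "inv i j" "inv i j'"] strict_mono_on_less[OF mono, of "inv i j" "inv i j'"]
    by (simp_all add: inv(2))
  then have "orders_as n (\<lambda>j. fst (z j)) (inv i)" "orders_as n (\<lambda>j. snd (z j)) (\<pi> \<circ> inv i)"
    using inv(1) permutes_compose[OF inv(1) \<pi>] unfolding orders_as_def by simp_all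
  then show "\<exists>r. orders_as n (\<lambda>j. fst (z j)) r \<and> orders_as n (\<lambda>j. snd (z j)) (\<pi> \<circ> r)"
    by blast
next
  assume "\<exists>r. orders_as n (\<lambda>j. fst (z j)) r \<and> orders_as n (\<lambda>j. snd (z j)) (\<pi> \<circ> r)"
  then obtain r where r: "orders_as n (\<lambda>j. fst (z j)) r" "orders_as n (\<lambda>j. snd (z j)) (\<pi> \<circ> r)"
    by blast
  then have p: "r permutes {1..n}" "\<pi> \<circ> r permutes {1..n}"
    by (auto simp: orders_as_def)
  have inv: "inv r permutes {1..n}" "\<And>j. r (inv r j) = j"
    using p by (auto simp: permutes_inv permutes_inverses)
  have "(\<pi> \<circ> r) \<circ> inv r = \<pi>"
    using inv(2) by (auto simp: fun_eq_iff)
  then have "\<pi> permutes {1..n}"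
    using permutes_compose[OF inv(1) p(2)] by simp
  moreover have in_inv: "j \<in> {1..n} \<Longrightarrow> inv r j \<in> {1..n}" for j
    using permutes_in_image[OF inv(1)] by simp
  have "fst (z (inv r j)) < fst (z (inv r j')) \<longleftrightarrow> j < j'"
    "snd (z (inv r j)) < snd (z (inv r j')) \<longleftrightarrow> \<pi> j < \<pi> j'"
    if "j \<in> {1..n}" "j' \<in> {1..n}" for j j'
  proof -
    have "r (inv r j) < r (inv r j') \<longleftrightarrow> fst (z (inv r j)) < fst (z (inv r j'))"
      "(\<pi> \<circ> r) (inv r j) < (\<pi> \<circ> r) (inv r j') \<longleftrightarrow> snd (z (inv r j)) < snd (z (inv r j'))"
      using r in_inv[OF that(1)] in_inv[OF that(2)] unfolding orders_as_def by blast+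
    then show "fst (z (inv r j)) < fst (z (inv r j')) \<longleftrightarrow> j < j'"
      "snd (z (inv r j)) < snd (z (inv r j')) \<longleftrightarrow> \<pi> j < \<pi> j'"
      by (simp_all add: inv(2))
  qed
  then have "strict_mono_on {1..n} (\<lambda>j. fst (z (inv r j)))"
    "\<forall>j\<in>{1..n}. \<forall>j'\<in>{1..n}. \<pi> j < \<pi> j' \<longleftrightarrow> snd (z (inv r j)) < snd (z (inv r j'))"
    by (simp_all add: strict_mono_on_def)
  ultimately show "is_pattern n z \<pi>"
    unfolding is_pattern_def using inv(1) by blast
qed

lemma is_pattern_unique:
  assumes "is_pattern n z \<pi>" "is_pattern n z \<pi>'"
  shows "\<pi> = \<pi>'"
proof -
  obtain r r' where r: "orders_as n (\<lambda>j. fst (z j)) r" "orders_as n (\<lambda>j. snd (z j)) (\<pi> \<circ> r)"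
    and r': "orders_as n (\<lambda>j. fst (z j)) r'" "orders_as n (\<lambda>j. snd (z j)) (\<pi>' \<circ> r')"
    using assms by (auto simp: is_pattern_iff_orders_as)
  \<comment> \<open>Both rank permutations are determined by \<open>z\<close>; cancelling the common
    \<open>r\<close> on the right leaves the two patterns equal.\<close>
  have "r = r'" "\<pi> \<circ> r = \<pi>' \<circ> r'"
    using r r' orders_as_unique by blast+
  moreover have "r permutes {1..n}"
    using r by (simp add: orders_as_def)
  then have "r \<circ> inv r = id"
    by (rule permutes_inv_o)
  ultimately show ?thesis
    by (metis comp_assoc comp_id)
qed

lemma is_pattern_exists:
  assumes "inj_on (\<lambda>j. fst (z j)) {1..n}" "inj_on (\<lambda>j. snd (z j)) {1..n}"
  shows "\<exists>\<pi>. is_pattern n z \<pi>"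
proof -
  obtain r s where r: "orders_as n (\<lambda>j. fst (z j)) r" and s: "orders_as n (\<lambda>j. snd (z j)) s"
    using assms orders_as_exists by blast
  \<comment> \<open>The pattern has to be \<open>s \<circ> inv r\<close>: from an x-rank to the
    label, then to the y-rank.\<close>
  have "inv r \<circ> r = id"
    using r by (auto simp: orders_as_def dest: permutes_inv_o)
  then have "(s \<circ> inv r) \<circ> r = s"
    by (simp add: comp_assoc)
  with r s show ?thesis
    unfolding is_pattern_iff_orders_as by metis
qed

section \<open>Dominance events and their invariance under order isomorphism\<close>

text \<open>Weak inequalities match the closed rectangles in \<open>permuton_cdf\<close>. The
  coordinate types are general so that the same notion applies to real points and to pairs of ranks.
  An index in both \<open>A\<close> and \<open>B\<close> is confined to the lower left quadrant of
  point \<open>i\<close>.\<close>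

definition dominates :: "nat set \<Rightarrow> nat set \<Rightarrow> nat \<Rightarrow> (nat \<Rightarrow> 'a::ord \<times> 'b::ord) \<Rightarrow> bool" where
  "dominates A B i z \<longleftrightarrow>
     (\<forall>a\<in>A. fst (z a) \<le> fst (z i)) \<and> (\<forall>b\<in>B. snd (z b) \<le> snd (z i))"

text \<open>The pairs \<open>(j, \<sigma> j)\<close> form the model configuration with pattern
  \<open>\<sigma>\<close>; the number counts its relabellings in which the dominance event
  occurs.\<close>

definition dominance_count :: "nat set \<Rightarrow> nat set \<Rightarrow> nat \<Rightarrow> nat \<Rightarrow> (nat \<Rightarrow> nat) \<Rightarrow> nat" where
  "dominance_count A B i n \<sigma> =
     card {\<tau>. \<tau> permutes {1..n} \<and> dominates A B i (\<lambda>j. (\<tau> j, \<sigma> (\<tau> j)))}"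

text \<open>Dominance depends only on comparisons of coordinates, so each point may be replaced by
  its pair of ranks. This turns a relabelling \<open>\<tau>\<close> of \<open>z\<close> into the
  relabelling \<open>r \<circ> \<tau>\<close> of the model configuration, and composing with
  \<open>r\<close> is a bijection on permutations.\<close>

lemma card_dominates_eq_count:
  assumes pat: "is_pattern n z \<sigma>" and AB: "A \<subseteq> {1..n}" "B \<subseteq> {1..n}" "i \<in> {1..n}"
  shows "card {\<tau>. \<tau> permutes {1..n} \<and> dominates A B i (z \<circ> \<tau>)} = dominance_count A B i n \<sigma>"
proof -
  obtain r where r: "orders_as n (\<lambda>j. fst (z j)) r" "orders_as n (\<lambda>j. snd (z j)) (\<sigma> \<circ> r)"
    using pat by (auto simp: is_pattern_iff_orders_as)
  then have p: "r permutes {1..n}"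
    by (simp add: orders_as_def)
  have le: "fst (z j) \<le> fst (z j') \<longleftrightarrow> r j \<le> r j'"
    "snd (z j) \<le> snd (z j') \<longleftrightarrow> \<sigma> (r j) \<le> \<sigma> (r j')" if "j \<in> {1..n}" "j' \<in> {1..n}" for j j'
    using r that by (auto simp: orders_as_def not_less[symmetric])
  have dom: "dominates A B i (z \<circ> \<tau>) \<longleftrightarrow> dominates A B i (\<lambda>j. ((r \<circ> \<tau>) j, \<sigma> ((r \<circ> \<tau>) j)))"
    if \<tau>: "\<tau> permutes {1..n}" for \<tau>
  proof -
    have "\<tau> j \<in> {1..n}" if "j \<in> {1..n}" for j
      using that permutes_in_image[OF \<tau>] by simp
    then show ?thesis
      using AB le unfolding dominates_def by (simp add: subset_iff)
  qed
  have inv: "r \<circ> inv r = id" "inv r \<circ> r = id"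
    using permutes_inv_o[OF p] by auto
  have c: "r \<circ> (inv r \<circ> \<tau>) = \<tau>" "inv r \<circ> (r \<circ> \<tau>) = \<tau>" for \<tau>
    using inv by (simp_all add: comp_assoc[symmetric])
  have "bij_betw ((\<circ>) r) {\<tau>. \<tau> permutes {1..n} \<and> dominates A B i (z \<circ> \<tau>)}
      {\<tau>. \<tau> permutes {1..n} \<and> dominates A B i (\<lambda>j. (\<tau> j, \<sigma> (\<tau> j)))}"
  proof (rule bij_betw_byWitness[where f' = "(\<circ>) (inv r)"])
    show "(\<circ>) r ` {\<tau>. \<tau> permutes {1..n} \<and> dominates A B i (z \<circ> \<tau>)} \<subseteq>
        {\<tau>. \<tau> permutes {1..n} \<and> dominates A B i (\<lambda>j. (\<tau> j, \<sigma> (\<tau> j)))}"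
      using dom permutes_compose[OF _ p] by auto
    show "(\<circ>) (inv r) ` {\<tau>. \<tau> permutes {1..n} \<and> dominates A B i (\<lambda>j. (\<tau> j, \<sigma> (\<tau> j)))} \<subseteq>
        {\<tau>. \<tau> permutes {1..n} \<and> dominates A B i (z \<circ> \<tau>)}"
    proof clarify
      fix \<tau> assume \<tau>: "\<tau> permutes {1..n}" "dominates A B i (\<lambda>j. (\<tau> j, \<sigma> (\<tau> j)))"
      have "inv r \<circ> \<tau> permutes {1..n}"
        using permutes_compose[OF \<tau>(1) permutes_inv[OF p]] .
      with dom[OF this] \<tau>(2) show "inv r \<circ> \<tau> permutes {1..n} \<and> dominates A B i (z \<circ> (inv r \<circ> \<tau>))"
        unfolding c by simp
    qed
  qed (use c in auto)
  then show ?thesis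
    unfolding dominance_count_def by (rule bij_betw_same_card)
qed

section \<open>Conditioning on one of several independent points\<close>

text \<open>Fubini with coordinate \<open>i\<close> integrated last: once \<open>z i = w\<close> is
  fixed, the conditions on the other coordinates are independent, so their probabilities multiply.
  It serves both to show that ties are null and to compute the dominance probability.\<close>

lemma (in prob_space) emeasure_PiM_insert:
  assumes "finite I" "i \<notin> I"
    and meas: "\<And>j. j \<in> I \<Longrightarrow> {p \<in> space (M \<Otimes>\<^sub>M M). R j (fst p) (snd p)} \<in> sets (M \<Otimes>\<^sub>M M)"
  shows "{z \<in> space (PiM (insert i I) (\<lambda>_. M)). \<forall>j\<in>I. R j (z i) (z j)} \<in> sets (PiM (insert i I) (\<lambda>_. M))"
      (is "?E \<in> sets ?P")
    and "emeasure (PiM (insert i I) (\<lambda>_. M))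
       {z \<in> space (PiM (insert i I) (\<lambda>_. M)). \<forall>j\<in>I. R j (z i) (z j)} =
     (\<integral>\<^sup>+ w. (\<Prod>j\<in>I. emeasure M {v \<in> space M. R j w v}) \<partial>M)"
proof -
  interpret P: product_sigma_finite "\<lambda>_. M"
    by standard
  have pred: "Measurable.pred (M \<Otimes>\<^sub>M M) (\<lambda>p. R j (fst p) (snd p))" if "j \<in> I" for j
    using meas[OF that] by (simp add: pred_def)
  have "Measurable.pred ?P (\<lambda>z. R j (z i) (z j))" if "j \<in> I" for j
  proof -
    have "(\<lambda>z. (z i, z j)) \<in> ?P \<rightarrow>\<^sub>M M \<Otimes>\<^sub>M M"
      using that by (intro measurable_Pair measurable_component_singleton) auto
    from measurable_compose[OF this pred[OF that]] show ?thesis by simp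
  qed
  then show E: "?E \<in> sets ?P"
    using assms(1) by (intro sets.sets_Collect_finite_All) (auto simp: pred_def)
  have Rsets: "{v \<in> space M. R j w v} \<in> sets M" if "j \<in> I" "w \<in> space M" for j w
  proof -
    have "Pair w \<in> M \<rightarrow>\<^sub>M M \<Otimes>\<^sub>M M"
      using that by simp
    from measurable_compose[OF this pred[OF that(1)]] show ?thesis
      by (simp add: pred_def)
  qed
  have "emeasure ?P ?E = (\<integral>\<^sup>+ z. indicator ?E z \<partial>?P)"
    using E by simp
  also have "\<dots> = (\<integral>\<^sup>+ w. (\<integral>\<^sup>+ y. indicator ?E (y(i := w)) \<partial>PiM I (\<lambda>_. M)) \<partial>M)"
    using E assms by (intro P.product_nn_integral_insert_rev) auto
  also have "\<dots> = (\<integral>\<^sup>+ w. (\<Prod>j\<in>I. emeasure M {v \<in> space M. R j w v}) \<partial>M)"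
  proof (rule nn_integral_cong)
    fix w assume w: "w \<in> space M"
    \<comment> \<open>For fixed \<open>w\<close> the section of the event is a box, one side for
      each \<open>j\<close>.\<close>
    have "(\<integral>\<^sup>+ y. indicator ?E (y(i := w)) \<partial>PiM I (\<lambda>_. M)) =
        (\<integral>\<^sup>+ y. indicator (PiE I (\<lambda>j. {v \<in> space M. R j w v})) y \<partial>PiM I (\<lambda>_. M))"
    proof (rule nn_integral_cong)
      fix y assume y: "y \<in> space (PiM I (\<lambda>_. M))"
      have "y(i := w) \<in> space ?P"
        using y w by (auto simp: space_PiM PiE_def extensional_def)
      moreover have "(y(i := w)) j = y j" if "j \<in> I" for j
        using that assms(2) by auto
      ultimately have "y(i := w) \<in> ?E \<longleftrightarrow> y \<in> PiE I (\<lambda>j. {v \<in> space M. R j w v})"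
        using y by (auto simp: space_PiM PiE_iff)
      then show "indicator ?E (y(i := w)) =
          (indicator (PiE I (\<lambda>j. {v \<in> space M. R j w v})) y :: ennreal)"
        by (simp add: indicator_def)
    qed
    also have "\<dots> = (\<Prod>j\<in>I. emeasure M {v \<in> space M. R j w v})"
      using assms(1) Rsets[OF _ w] by (simp add: sets_PiM_I_finite P.emeasure_PiM)
    finally show "(\<integral>\<^sup>+ y. indicator ?E (y(i := w)) \<partial>PiM I (\<lambda>_. M)) =
        (\<Prod>j\<in>I. emeasure M {v \<in> space M. R j w v})" .
  qed
  finally show "emeasure ?P ?E = (\<integral>\<^sup>+ w. (\<Prod>j\<in>I. emeasure M {v \<in> space M. R j w v}) \<partial>M)" .
qed

text \<open>Given one point, a second independent point hits the fibre of \<open>f\<close> through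
  it with probability zero; only finitely many pairs of indices have to be considered.\<close>

lemma (in prob_space) AE_PiM_inj_on:
  fixes f :: "'a \<Rightarrow> real"
  assumes f[measurable]: "f \<in> borel_measurable M" and "finite I"
    and null: "\<And>w. w \<in> space M \<Longrightarrow> emeasure M {v \<in> space M. f v = f w} = 0"
  shows "AE z in PiM I (\<lambda>_. M). inj_on (\<lambda>j. f (z j)) I"
proof -
  have "AE z in PiM I (\<lambda>_. M). f (z j) \<noteq> f (z i)" if ij: "i \<in> I" "j \<in> I" "i \<noteq> j" for i j
  proof -
    \<comment> \<open>The condition binds coordinate \<open>j\<close> only. The product formula then
      contains a zero factor at \<open>j\<close>, whatever the other factors are.\<close>
    define R where "R l w v \<longleftrightarrow> (l = j \<longrightarrow> f v = f w)" for l w v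
    have meas: "{p \<in> space (M \<Otimes>\<^sub>M M). R l (fst p) (snd p)} \<in> sets (M \<Otimes>\<^sub>M M)" for l
      unfolding R_def by measurable
    have I: "insert i (I - {i}) = I"
      using ij by auto
    have eq: "{z \<in> space (PiM I (\<lambda>_. M)). \<not> f (z j) \<noteq> f (z i)} =
        {z \<in> space (PiM I (\<lambda>_. M)). \<forall>l\<in>I - {i}. R l (z i) (z l)}"
      using ij by (auto simp: R_def)
    have "emeasure (PiM I (\<lambda>_. M)) {z \<in> space (PiM I (\<lambda>_. M)). \<forall>l\<in>I - {i}. R l (z i) (z l)} =
        (\<integral>\<^sup>+ w. (\<Prod>l\<in>I - {i}. emeasure M {v \<in> space M. R l w v}) \<partial>M)"
      using emeasure_PiM_insert(2)[of "I - {i}" i R] assms(2) meas unfolding I by simp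
    also have "\<dots> = (\<integral>\<^sup>+ w. 0 \<partial>M)"
    proof (rule nn_integral_cong)
      fix w assume "w \<in> space M"
      with null have "emeasure M {v \<in> space M. R j w v} = 0"
        by (simp add: R_def)
      then show "(\<Prod>l\<in>I - {i}. emeasure M {v \<in> space M. R l w v}) = 0"
        using ij assms(2) by (intro prod_zero) auto
    qed
    finally have "emeasure (PiM I (\<lambda>_. M)) {z \<in> space (PiM I (\<lambda>_. M)). \<not> f (z j) \<noteq> f (z i)} = 0"
      unfolding eq by simp
    moreover have "{z \<in> space (PiM I (\<lambda>_. M)). \<not> f (z j) \<noteq> f (z i)} \<in> sets (PiM I (\<lambda>_. M))"
      unfolding eq using emeasure_PiM_insert(1)[of "I - {i}" i R] assms(2) meas unfolding I by simp
    ultimately show ?thesis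
      by (intro AE_I[OF subset_refl])
  qed
  then have "AE z in PiM I (\<lambda>_. M). \<forall>i\<in>I. \<forall>j\<in>I. i \<noteq> j \<longrightarrow> f (z j) \<noteq> f (z i)"
    using assms(2) by (auto simp: AE_finite_all)
  then show ?thesis
    by eventually_elim (auto simp: inj_on_def)
qed

section \<open>Consequences of uniform marginals\<close>

lemma permuton_space: "permuton \<mu> \<Longrightarrow> space \<mu> = unit_square"
  using sets_eq_imp_space_eq[of \<mu> "restrict_space borel unit_square"]
  by (simp add: permuton_def space_restrict_space)

lemma permuton_measurable:
  assumes "permuton \<mu>"
  shows "fst \<in> borel_measurable \<mu>" "snd \<in> borel_measurable \<mu>"
  using assms measurable_cong_sets[of \<mu> "restrict_space borel unit_square" borel borel]
  by (auto simp: permuton_def borel_prod[symmetric] intro!: measurable_restrict_space1)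

text \<open>Within the unit square these sets are closed rectangles with a corner at the origin; the
  first two are full strips, evaluated by the marginals on an interval starting at 0.\<close>

lemma permuton_measure_le:
  assumes "permuton \<mu>" "w \<in> space \<mu>"
  shows "measure \<mu> {v \<in> space \<mu>. fst v \<le> fst w} = fst w"
    and "measure \<mu> {v \<in> space \<mu>. snd v \<le> snd w} = snd w"
    and "measure \<mu> {v \<in> space \<mu>. fst v \<le> fst w \<and> snd v \<le> snd w} = permuton_cdf \<mu> (fst w) (snd w)"
proof -
  note sp = permuton_space[OF assms(1)]
  have w: "0 \<le> fst w" "fst w \<le> 1" "0 \<le> snd w" "snd w \<le> 1"
    using assms(2) by (auto simp: sp)
  have marg: "measure \<mu> ({0..fst w} \<times> {0..1}) = fst w" "measure \<mu> ({0..1} \<times> {0..snd w}) = snd w"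
    using assms(1) w unfolding permuton_def by (metis diff_zero order_refl)+
  have "{v \<in> space \<mu>. fst v \<le> fst w} = {0..fst w} \<times> {0..1}"
    "{v \<in> space \<mu>. snd v \<le> snd w} = {0..1} \<times> {0..snd w}"
    "{v \<in> space \<mu>. fst v \<le> fst w \<and> snd v \<le> snd w} = {0..fst w} \<times> {0..snd w}"
    using w by (auto simp: sp)
  then show "measure \<mu> {v \<in> space \<mu>. fst v \<le> fst w} = fst w"
    "measure \<mu> {v \<in> space \<mu>. snd v \<le> snd w} = snd w"
    "measure \<mu> {v \<in> space \<mu>. fst v \<le> fst w \<and> snd v \<le> snd w} = permuton_cdf \<mu> (fst w) (snd w)"
    using marg by (simp_all add: permuton_cdf_def)
qed

text \<open>A fibre is the strip over a degenerate interval, and the marginals give such a strip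
  mass 0.\<close>

lemma permuton_fibre_null:
  assumes "permuton \<mu>" "w \<in> space \<mu>"
  shows "emeasure \<mu> {v \<in> space \<mu>. fst v = fst w} = 0"
    and "emeasure \<mu> {v \<in> space \<mu>. snd v = snd w} = 0"
proof -
  interpret prob_space \<mu>
    using assms(1) by (simp add: permuton_def)
  note sp = permuton_space[OF assms(1)]
  have w: "0 \<le> fst w" "fst w \<le> 1" "0 \<le> snd w" "snd w \<le> 1"
    using assms(2) by (auto simp: sp)
  have marg: "measure \<mu> ({fst w..fst w} \<times> {0..1}) = 0" "measure \<mu> ({0..1} \<times> {snd w..snd w}) = 0"
    using assms(1) w unfolding permuton_def by (metis diff_self order_refl)+
  have "{v \<in> space \<mu>. fst v = fst w} = {fst w..fst w} \<times> {0..1}"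
    "{v \<in> space \<mu>. snd v = snd w} = {0..1} \<times> {snd w..snd w}"
    using w by (auto simp: sp)
  then show "emeasure \<mu> {v \<in> space \<mu>. fst v = fst w} = 0"
    "emeasure \<mu> {v \<in> space \<mu>. snd v = snd w} = 0"
    using marg by (simp_all add: emeasure_eq_measure)
qed

lemma AE_is_pattern_exists:
  assumes "permuton \<mu>"
  shows "AE z in PiM {1..n} (\<lambda>_. \<mu>). \<exists>\<pi>. is_pattern n z \<pi>"
proof -
  interpret prob_space \<mu>
    using assms by (simp add: permuton_def)
  note m = permuton_measurable[OF assms] and null = permuton_fibre_null[OF assms]
  have "AE z in PiM {1..n} (\<lambda>_. \<mu>). inj_on (\<lambda>j. fst (z j)) {1..n}"
    "AE z in PiM {1..n} (\<lambda>_. \<mu>). inj_on (\<lambda>j. snd (z j)) {1..n}"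
    by (rule AE_PiM_inj_on[OF m(1) _ null(1)] AE_PiM_inj_on[OF m(2) _ null(2)]; simp)+
  then show ?thesis
    by eventually_elim (rule is_pattern_exists)
qed

section \<open>Averaging dominance over all relabellings\<close>

lemma sets_dominates:
  assumes "permuton \<mu>" "finite A" "finite B" "A \<subseteq> I" "B \<subseteq> I" "i \<in> I" "\<tau> \<in> I \<rightarrow> I"
  shows "{z \<in> space (PiM I (\<lambda>_. \<mu>)). dominates A B i (z \<circ> \<tau>)} \<in> sets (PiM I (\<lambda>_. \<mu>))"
proof -
  let ?P = "PiM I (\<lambda>_. \<mu>)"
  have m: "(\<lambda>z. fst (z (\<tau> j))) \<in> borel_measurable ?P" "(\<lambda>z. snd (z (\<tau> j))) \<in> borel_measurable ?P"
    if "j \<in> I" for j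
    using that assms(7) permuton_measurable[OF assms(1)]
    by (auto intro!: measurable_compose[OF measurable_component_singleton])
  have "{z \<in> space ?P. fst (z (\<tau> a)) \<le> fst (z (\<tau> i))} \<in> sets ?P"
    "{z \<in> space ?P. snd (z (\<tau> a)) \<le> snd (z (\<tau> i))} \<in> sets ?P" if "a \<in> I" for a
  proof -
    note [measurable] = m[OF that] m[OF assms(6)]
    show "{z \<in> space ?P. fst (z (\<tau> a)) \<le> fst (z (\<tau> i))} \<in> sets ?P"
      "{z \<in> space ?P. snd (z (\<tau> a)) \<le> snd (z (\<tau> i))} \<in> sets ?P"
      by measurable
  qed
  then show ?thesis
    using assms unfolding dominates_def comp_def
    by (intro sets.sets_Collect_conj sets.sets_Collect_finite_All) auto
qed

text \<open>This is exchangeability: a power of one probability measure is invariant under permuting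
  coordinates.\<close>

lemma measure_dominates_permute:
  assumes \<mu>: "permuton \<mu>" and AB: "finite A" "finite B" "A \<subseteq> I" "B \<subseteq> I" "i \<in> I"
    and \<tau>: "\<tau> permutes I"
  shows "measure (PiM I (\<lambda>_. \<mu>)) {z \<in> space (PiM I (\<lambda>_. \<mu>)). dominates A B i (z \<circ> \<tau>)} =
    measure (PiM I (\<lambda>_. \<mu>)) {z \<in> space (PiM I (\<lambda>_. \<mu>)). dominates A B i z}"
proof -
  let ?P = "PiM I (\<lambda>_. \<mu>)" and ?T = "\<lambda>z. \<lambda>j\<in>I. z (\<tau> j)"
  have \<tau>I: "\<tau> \<in> I \<rightarrow> I"
    using permutes_in_image[OF \<tau>] by auto
  have T: "?T \<in> ?P \<rightarrow>\<^sub>M ?P"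
    using \<tau>I by (intro measurable_restrict measurable_component_singleton) auto
  have E: "{z \<in> space ?P. dominates A B i z} \<in> sets ?P"
    using sets_dominates[OF \<mu> AB, of id] by simp
  have "distr ?P ?P ?T = ?P"
    using \<mu> \<tau>I permutes_inj_on[OF \<tau>] by (intro distr_PiM_reindex) (auto simp: permuton_def)
  then have "measure ?P {z \<in> space ?P. dominates A B i z} =
      measure (distr ?P ?P ?T) {z \<in> space ?P. dominates A B i z}"
    by simp
  also have "\<dots> = measure ?P (?T -` {z \<in> space ?P. dominates A B i z} \<inter> space ?P)"
    by (rule measure_distr[OF T E])
  \<comment> \<open>\<open>?T z\<close> and \<open>z \<circ> \<tau>\<close> agree on
    \<open>I\<close>, which contains every index that \<open>dominates\<close> inspects.\<close>
  also have "?T -` {z \<in> space ?P. dominates A B i z} \<inter> space ?P =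
      {z \<in> space ?P. dominates A B i (z \<circ> \<tau>)}"
    using AB measurable_space[OF T] by (auto simp: dominates_def subset_iff)
  finally show ?thesis ..
qed

text \<open>Double counting of pairs of a relabelling and a configuration. Summed over relabellings,
  the event has expectation \<open>fact n\<close> times its probability; summed over patterns, the
  same expectation is a combination of densities.\<close>

lemma measure_dominates_eq_sum_density:
  assumes \<mu>: "permuton \<mu>" and AB: "A \<subseteq> {1..n}" "B \<subseteq> {1..n}" "i \<in> {1..n}"
  shows "measure (PiM {1..n} (\<lambda>_. \<mu>)) {z \<in> space (PiM {1..n} (\<lambda>_. \<mu>)). dominates A B i z} =
    (\<Sum>\<sigma> | \<sigma> permutes {1..n}. real (dominance_count A B i n \<sigma>) / fact n * pattern_density (n, \<sigma>) \<mu>)"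
proof -
  let ?P = "PiM {1..n} (\<lambda>_. \<mu>)" and ?S = "{\<tau>. \<tau> permutes {1..n}}"
  interpret P: prob_space ?P
    using \<mu> by (intro prob_space_PiM) (simp add: permuton_def)
  define D where "D \<tau> = {z \<in> space ?P. dominates A B i (z \<circ> \<tau>)}" for \<tau>
  define E where "E \<sigma> = {z \<in> space ?P. is_pattern n z \<sigma>}" for \<sigma>
  have fin: "finite A" "finite B" "finite ?S"
    using AB by (auto intro: finite_subset finite_permutations)
  have D: "D \<tau> \<in> sets ?P" if "\<tau> \<in> ?S" for \<tau>
    unfolding D_def using that permutes_in_image[of \<tau> "{1..n}"]
    by (intro sets_dominates \<mu> fin AB) auto
  have E: "E \<sigma> \<in> sets ?P" for \<sigma>
    unfolding E_def by (rule pattern_event_measurable[OF \<mu>])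
  have ind: "integrable ?P (indicat_real X)" "(\<integral>z. indicat_real X z \<partial>?P) = measure ?P X"
    if "X \<in> sets ?P" for X
    using that sets.sets_into_space[OF that]
    by (simp_all del: One_nat_def add: P.emeasure_eq_measure Int_absorb2)
  \<comment> \<open>Almost surely \<open>z\<close> has exactly one pattern, so a single term on the
    right survives, and it equals the number of relabellings counted on the left.\<close>
  have pointwise: "AE z in ?P. (\<Sum>\<tau>\<in>?S. indicat_real (D \<tau>) z) =
      (\<Sum>\<sigma>\<in>?S. real (dominance_count A B i n \<sigma>) * indicat_real (E \<sigma>) z)"
    using AE_is_pattern_exists[OF \<mu>, of n] AE_space[of ?P]
  proof eventually_elim
    fix z assume "\<exists>\<pi>. is_pattern n z \<pi>" and z: "z \<in> space ?P"
    then obtain \<pi> where \<pi>: "is_pattern n z \<pi>"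
      by blast
    then have "\<pi> \<in> ?S"
      by (simp add: is_pattern_def)
    have "(\<Sum>\<tau>\<in>?S. indicat_real (D \<tau>) z) = real (card {\<tau> \<in> ?S. z \<in> D \<tau>})"
      using fin(3) by (simp add: indicator_def sum.If_cases Int_def)
    also have "\<dots> = real (dominance_count A B i n \<pi>)"
      using card_dominates_eq_count[OF \<pi> AB] z by (simp add: D_def)
    also have "\<dots> = (\<Sum>\<sigma>\<in>?S. if \<sigma> = \<pi> then real (dominance_count A B i n \<sigma>) else 0)"
      using fin(3) \<open>\<pi> \<in> ?S\<close> by simp
    also have "\<dots> = (\<Sum>\<sigma>\<in>?S. real (dominance_count A B i n \<sigma>) * indicat_real (E \<sigma>) z)"
    proof (rule sum.cong[OF refl])
      fix \<sigma>
      have "z \<in> E \<sigma> \<longleftrightarrow> \<sigma> = \<pi>"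
        using \<pi> z is_pattern_unique unfolding E_def by blast
      then show "(if \<sigma> = \<pi> then real (dominance_count A B i n \<sigma>) else 0) =
          real (dominance_count A B i n \<sigma>) * indicat_real (E \<sigma>) z"
        by (simp add: indicator_def)
    qed
    finally show "(\<Sum>\<tau>\<in>?S. indicat_real (D \<tau>) z) =
        (\<Sum>\<sigma>\<in>?S. real (dominance_count A B i n \<sigma>) * indicat_real (E \<sigma>) z)" .
  qed
  have "fact n * measure ?P {z \<in> space ?P. dominates A B i z} = (\<Sum>\<tau>\<in>?S. measure ?P (D \<tau>))"
    using measure_dominates_permute[OF \<mu> fin(1,2) AB] card_permutations[of "{1..n}" n]
    by (simp add: D_def)
  also have "\<dots> = (\<Sum>\<tau>\<in>?S. \<integral>z. indicat_real (D \<tau>) z \<partial>?P)"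
    by (intro sum.cong refl ind(2)[symmetric] D)
  also have "\<dots> = (\<integral>z. (\<Sum>\<tau>\<in>?S. indicat_real (D \<tau>) z) \<partial>?P)"
    by (intro Bochner_Integration.integral_sum[symmetric] ind(1) D)
  also have "\<dots> = (\<integral>z. (\<Sum>\<sigma>\<in>?S. real (dominance_count A B i n \<sigma>) * indicat_real (E \<sigma>) z) \<partial>?P)"
    by (rule integral_cong_AE[OF _ _ pointwise];
        intro borel_measurable_sum borel_measurable_times borel_measurable_const
          borel_measurable_indicator D E; assumption)
  also have "\<dots> = (\<Sum>\<sigma>\<in>?S. \<integral>z. real (dominance_count A B i n \<sigma>) * indicat_real (E \<sigma>) z \<partial>?P)"
    by (intro Bochner_Integration.integral_sum integrable_mult_right ind(1) E)
  also have "\<dots> = (\<Sum>\<sigma>\<in>?S. real (dominance_count A B i n \<sigma>) * measure ?P (E \<sigma>))"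
    by (intro sum.cong refl) (subst integral_mult_right_zero, subst ind(2)[OF E], rule refl)
  finally have "measure ?P {z \<in> space ?P. dominates A B i z} =
      (\<Sum>\<sigma>\<in>?S. real (dominance_count A B i n \<sigma>) * measure ?P (E \<sigma>)) / fact n"
    by (subst eq_divide_eq) (simp add: mult.commute)
  then show ?thesis
    by (simp add: E_def sum_divide_distrib)
qed

section \<open>The monomial integral as a dominance probability\<close>

text \<open>On the space of \<open>\<mu>\<close> the function is the measure of a section of a
  measurable set of pairs \<open>(w, v)\<close>, which depends measurably on
  \<open>w\<close>.\<close>

lemma permuton_cdf_measurable:
  assumes "permuton \<mu>"
  shows "(\<lambda>w. permuton_cdf \<mu> (fst w) (snd w)) \<in> borel_measurable \<mu>"
proof -
  interpret prob_space \<mu>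
    using assms by (simp add: permuton_def)
  note [measurable] = permuton_measurable[OF assms]
  have "(\<lambda>w. measure \<mu> {v \<in> space \<mu>. fst v \<le> fst w \<and> snd v \<le> snd w}) \<in> borel_measurable \<mu>"
    by measurable
  then show ?thesis
    by (subst measurable_cong[OF permuton_measure_le(3)[OF assms, symmetric]])
qed

lemma integrable_monomial_cdf:
  assumes "permuton \<mu>"
  shows "integrable \<mu> (\<lambda>w. fst w ^ a * permuton_cdf \<mu> (fst w) (snd w) ^ k * snd w ^ b)"
proof -
  interpret prob_space \<mu>
    using assms by (simp add: permuton_def)
  note [measurable] = permuton_measurable[OF assms] permuton_cdf_measurable[OF assms]
  have "norm (fst w ^ a * permuton_cdf \<mu> (fst w) (snd w) ^ k * snd w ^ b) \<le> 1"
    if "w \<in> space \<mu>" for w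
  proof -
    have "0 \<le> fst w" "fst w \<le> 1" "0 \<le> snd w" "snd w \<le> 1"
      using that by (auto simp: permuton_space[OF assms])
    moreover have "0 \<le> permuton_cdf \<mu> (fst w) (snd w)" "permuton_cdf \<mu> (fst w) (snd w) \<le> 1"
      by (auto simp: permuton_cdf_def)
    ultimately show ?thesis
      by (simp add: abs_mult power_abs power_le_one mult_le_one)
  qed
  then show ?thesis
    by (intro integrable_const_bound[where B = 1]) auto
qed

text \<open>Point 1 is the reference point. Of the others, the first \<open>a\<close> must lie to
  its left, the next \<open>k\<close> both to its left and below, and the last \<open>b\<close>
  below. Conditioned on the reference point \<open>w\<close>, these independent conditions
  contribute the factors of the integrand.\<close>

lemma measure_dominates_eq_integral:
  fixes a k b :: nat
  assumes \<mu>: "permuton \<mu>"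
  defines "P \<equiv> PiM {1..1 + a + k + b} (\<lambda>_. \<mu>)"
  shows "measure P {z \<in> space P. dominates {2..<2 + a + k} {2 + a..<2 + a + k + b} 1 z} =
    (\<integral>w. fst w ^ a * permuton_cdf \<mu> (fst w) (snd w) ^ k * snd w ^ b \<partial>\<mu>)"
proof -
  interpret prob_space \<mu>
    using \<mu> by (simp add: permuton_def)
  let ?A = "{2..<2 + a + k}" and ?B = "{2 + a..<2 + a + k + b}" and ?I = "{2..<2 + a + k + b}"
  \<comment> \<open>Both requirements are merged into one per index, so that each index of the
    overlap contributes a single factor \<open>F w\<close> and not a product of two
    marginals.\<close>
  define R where "R j w v \<longleftrightarrow> (j \<in> ?A \<longrightarrow> fst v \<le> fst w) \<and> (j \<in> ?B \<longrightarrow> snd v \<le> snd w)"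
    for j and w v :: "real \<times> real"
  define F where "F w = permuton_cdf \<mu> (fst w) (snd w)" for w
  note [measurable] = permuton_measurable[OF \<mu>] permuton_cdf_measurable[OF \<mu>, folded F_def]
  have meas: "{p \<in> space (\<mu> \<Otimes>\<^sub>M \<mu>). R j (fst p) (snd p)} \<in> sets (\<mu> \<Otimes>\<^sub>M \<mu>)" for j
    unfolding R_def by measurable
  have P: "P = PiM (insert 1 ?I) (\<lambda>_. \<mu>)"
    unfolding P_def by (rule arg_cong2[where f = PiM]) auto
  have "{z \<in> space P. dominates ?A ?B 1 z} = {z \<in> space P. \<forall>j\<in>?I. R j (z 1) (z j)}"
    by (auto simp: dominates_def R_def)
  then have "emeasure P {z \<in> space P. dominates ?A ?B 1 z} =
      (\<integral>\<^sup>+ w. (\<Prod>j\<in>?I. emeasure \<mu> {v \<in> space \<mu>. R j w v}) \<partial>\<mu>)"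
    using emeasure_PiM_insert(2)[of ?I 1 R, OF _ _ meas] unfolding P by simp
  also have "\<dots> = (\<integral>\<^sup>+ w. ennreal (fst w ^ a * F w ^ k * snd w ^ b) \<partial>\<mu>)"
  proof (rule nn_integral_cong)
    fix w assume w: "w \<in> space \<mu>"
    have nonneg: "0 \<le> fst w" "0 \<le> snd w" "0 \<le> F w"
      using w by (auto simp: permuton_space[OF \<mu>] F_def permuton_cdf_def)
    have eq: "emeasure \<mu> {v \<in> space \<mu>. R j w v} =
        ennreal (if j < 2 + a then fst w else if j < 2 + a + k then F w else snd w)"
      if "j \<in> ?I" for j
      using that permuton_measure_le[OF \<mu> w]
      by (auto simp: R_def F_def emeasure_eq_measure)
    have "(\<Prod>j\<in>?I. emeasure \<mu> {v \<in> space \<mu>. R j w v}) =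
        (\<Prod>j\<in>?I. ennreal (if j < 2 + a then fst w else if j < 2 + a + k then F w else snd w))"
      by (intro prod.cong refl eq)
    also have "\<dots> =
        ennreal (\<Prod>j\<in>?I. if j < 2 + a then fst w else if j < 2 + a + k then F w else snd w)"
      using nonneg by (intro prod_ennreal) simp
    also have "(\<Prod>j\<in>?I. if j < 2 + a then fst w else if j < 2 + a + k then F w else snd w) =
        (\<Prod>j\<in>{2..<2 + a}. fst w) * (\<Prod>j\<in>{2 + a..<2 + a + k}. F w) *
        (\<Prod>j\<in>{2 + a + k..<2 + a + k + b}. snd w)"
    proof -
      let ?g = "\<lambda>j. if j < 2 + a then fst w else if j < 2 + a + k then F w else snd w"
      have "prod ?g ?I = prod ?g {2..<2 + a} * prod ?g {2 + a..<2 + a + k} *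
          prod ?g {2 + a + k..<2 + a + k + b}"
        by (subst prod.atLeastLessThan_concat, simp, simp)+ (rule refl)
      also have "prod ?g {2..<2 + a} = (\<Prod>j\<in>{2..<2 + a}. fst w)"
        by (rule prod.cong) auto
      also have "prod ?g {2 + a..<2 + a + k} = (\<Prod>j\<in>{2 + a..<2 + a + k}. F w)"
        by (rule prod.cong) auto
      also have "prod ?g {2 + a + k..<2 + a + k + b} = (\<Prod>j\<in>{2 + a + k..<2 + a + k + b}. snd w)"
        by (rule prod.cong) auto
      finally show ?thesis .
    qed
    finally show "(\<Prod>j\<in>?I. emeasure \<mu> {v \<in> space \<mu>. R j w v}) =
        ennreal (fst w ^ a * F w ^ k * snd w ^ b)"
      by simp
  qed
  finally have "measure P {z \<in> space P. dominates ?A ?B 1 z} =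
      enn2real (\<integral>\<^sup>+ w. ennreal (fst w ^ a * F w ^ k * snd w ^ b) \<partial>\<mu>)"
    by (simp add: measure_def)
  also have "\<dots> = (\<integral>w. fst w ^ a * F w ^ k * snd w ^ b \<partial>\<mu>)"
  proof (rule integral_eq_nn_integral[symmetric])
    show "(\<lambda>w. fst w ^ a * F w ^ k * snd w ^ b) \<in> borel_measurable \<mu>"
      by measurable
    show "AE w in \<mu>. 0 \<le> fst w ^ a * F w ^ k * snd w ^ b"
      by (intro AE_I2) (auto simp: permuton_space[OF \<mu>] F_def permuton_cdf_def)
  qed
  finally show ?thesis
    by (simp add: F_def)
qed

section \<open>Linear combinations of pattern densities\<close>

text \<open>The functionals that the theorem speaks of, named so that closure under linear
  operations can be proved. \<open>S\<close> and \<open>\<gamma>\<close> are chosen before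
  \<open>\<mu>\<close>, and values off permutons are left free.\<close>

definition density_combination :: "((real \<times> real) measure \<Rightarrow> real) \<Rightarrow> bool" where
  "density_combination L \<longleftrightarrow> (\<exists>S \<gamma>. finite S \<and> S \<subseteq> perms \<and>
     (\<forall>\<mu>. permuton \<mu> \<longrightarrow> L \<mu> = (\<Sum>\<sigma>\<in>S. \<gamma> \<sigma> * pattern_density \<sigma> \<mu>)))"

lemma density_combination_cong:
  assumes "density_combination L" "\<And>\<mu>. permuton \<mu> \<Longrightarrow> L' \<mu> = L \<mu>"
  shows "density_combination L'"
  using assms unfolding density_combination_def by metis

lemma density_combination_cmult:
  assumes "density_combination L"
  shows "density_combination (\<lambda>\<mu>. c * L \<mu>)"
proof -
  obtain S \<gamma> where "finite S" "S \<subseteq> perms"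
    and "\<And>\<mu>. permuton \<mu> \<Longrightarrow> L \<mu> = (\<Sum>\<sigma>\<in>S. \<gamma> \<sigma> * pattern_density \<sigma> \<mu>)"
    using assms unfolding density_combination_def by blast
  then show ?thesis
    unfolding density_combination_def
    by (intro exI[of _ S] exI[of _ "\<lambda>\<sigma>. c * \<gamma> \<sigma>"]) (simp add: sum_distrib_left mult.assoc)
qed

lemma density_combination_add:
  assumes "density_combination L" "density_combination L'"
  shows "density_combination (\<lambda>\<mu>. L \<mu> + L' \<mu>)"
proof -
  obtain S \<gamma> where S: "finite S" "S \<subseteq> perms"
    and L: "\<And>\<mu>. permuton \<mu> \<Longrightarrow> L \<mu> = (\<Sum>\<sigma>\<in>S. \<gamma> \<sigma> * pattern_density \<sigma> \<mu>)"
    using assms(1) unfolding density_combination_def by blast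
  obtain S' \<gamma>' where S': "finite S'" "S' \<subseteq> perms"
    and L': "\<And>\<mu>. permuton \<mu> \<Longrightarrow> L' \<mu> = (\<Sum>\<sigma>\<in>S'. \<gamma>' \<sigma> * pattern_density \<sigma> \<mu>)"
    using assms(2) unfolding density_combination_def by blast
  \<comment> \<open>Both coefficient families are extended by zero to the union, so a permutation in
    \<open>S\<close> and \<open>S'\<close> receives the sum of its two coefficients.\<close>
  define \<delta> where "\<delta> \<sigma> = (if \<sigma> \<in> S then \<gamma> \<sigma> else 0) + (if \<sigma> \<in> S' then \<gamma>' \<sigma> else 0)" for \<sigma>
  have "(\<Sum>\<sigma>\<in>S \<union> S'. \<delta> \<sigma> * pattern_density \<sigma> \<mu>) =
      (\<Sum>\<sigma>\<in>S \<union> S'. if \<sigma> \<in> S then \<gamma> \<sigma> * pattern_density \<sigma> \<mu> else 0) +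
      (\<Sum>\<sigma>\<in>S \<union> S'. if \<sigma> \<in> S' then \<gamma>' \<sigma> * pattern_density \<sigma> \<mu> else 0)" for \<mu>
    unfolding sum.distrib[symmetric] by (intro sum.cong) (auto simp: \<delta>_def algebra_simps)
  also have "\<dots> \<mu> = (\<Sum>\<sigma>\<in>S. \<gamma> \<sigma> * pattern_density \<sigma> \<mu>) + (\<Sum>\<sigma>\<in>S'. \<gamma>' \<sigma> * pattern_density \<sigma> \<mu>)" for \<mu>
    using S(1) S'(1) by (simp add: sum.inter_restrict[symmetric] Int_absorb1)
  finally show ?thesis
    using S S' L L' unfolding density_combination_def
    by (intro exI[of _ "S \<union> S'"] exI[of _ \<delta>]) simp
qed

lemma density_combination_sum:
  assumes "finite T" "\<And>t. t \<in> T \<Longrightarrow> density_combination (L t)"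
  shows "density_combination (\<lambda>\<mu>. \<Sum>t\<in>T. L t \<mu>)"
  using assms
proof (induction T)
  case empty
  show ?case
    unfolding density_combination_def by (intro exI[of _ "{}"]) simp
next
  case (insert t T)
  then show ?case
    by (simp add: density_combination_add)
qed

lemma density_combination_monomial:
  "density_combination (\<lambda>\<mu>. \<integral>w. fst w ^ a * permuton_cdf \<mu> (fst w) (snd w) ^ k * snd w ^ b \<partial>\<mu>)"
proof -
  \<comment> \<open>The summand 1 is the reference point; it also makes \<open>n \<ge> 1\<close>, as
    \<open>perms\<close> requires, when all exponents vanish.\<close>
  define n where "n = 1 + a + k + b"
  let ?A = "{2..<2 + a + k}" and ?B = "{2 + a..<2 + a + k + b}" and ?S = "{\<sigma>. \<sigma> permutes {1..n}}"
  have "(\<integral>w. fst w ^ a * permuton_cdf \<mu> (fst w) (snd w) ^ k * snd w ^ b \<partial>\<mu>) =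
      (\<Sum>\<sigma>\<in>Pair n ` ?S. dominance_count ?A ?B 1 n (snd \<sigma>) / fact n * pattern_density \<sigma> \<mu>)"
    if "permuton \<mu>" for \<mu>
    using measure_dominates_eq_sum_density[OF that, of ?A n ?B 1]
      measure_dominates_eq_integral[OF that, of a k b]
    by (simp add: n_def sum.reindex inj_on_def subset_iff)
  moreover have "finite (Pair n ` ?S)" "Pair n ` ?S \<subseteq> perms"
    by (auto simp: finite_permutations perms_def n_def)
  ultimately show ?thesis
    unfolding density_combination_def
    by (intro exI[of _ "Pair n ` ?S"]
        exI[of _ "\<lambda>\<sigma>. real (dominance_count ?A ?B 1 n (snd \<sigma>)) / fact n"] conjI allI impI)
qed

section \<open>Expansion into monomials and conclusion\<close>

text \<open>The outer variable of \<open>p\<close> is y, so \<open>b\<close> runs over the outer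
  degree and \<open>a\<close> over the degree of each coefficient polynomial in x.\<close>

lemma poly2_eq_sum:
  "poly2 p x y = (\<Sum>b\<le>degree p. \<Sum>a\<le>degree (coeff p b). coeff (coeff p b) a * (x ^ a * y ^ b))"
proof -
  have "poly2 p x y = (\<Sum>b\<le>degree p. poly (coeff p b) x * y ^ b)"
    unfolding poly2_def poly_altdef[of p] by (simp add: poly_sum)
  also have "\<dots> = (\<Sum>b\<le>degree p. \<Sum>a\<le>degree (coeff p b). coeff (coeff p b) a * (x ^ a * y ^ b))"
    by (intro sum.cong refl) (simp only: poly_altdef sum_distrib_right mult.assoc)
  finally show ?thesis .
qed

theorem theorem3:
  fixes p :: "real poly poly" and k :: nat
  shows "\<exists>(S :: (nat \<times> (nat \<Rightarrow> nat)) set) (\<gamma> :: nat \<times> (nat \<Rightarrow> nat) \<Rightarrow> real).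
    finite S \<and> S \<subseteq> perms \<and>
    (\<forall>\<mu>. permuton \<mu> \<longrightarrow>
       (LINT (x, y)|\<mu>. poly2 p x y * permuton_cdf \<mu> x y ^ k) = (\<Sum>\<sigma>\<in>S. \<gamma> \<sigma> * pattern_density \<sigma> \<mu>))"
proof -
  let ?M = "\<lambda>\<mu> a b. \<integral>w. fst w ^ a * permuton_cdf \<mu> (fst w) (snd w) ^ k * snd w ^ b \<partial>\<mu>"
  \<comment> \<open>The Bochner integral is additive only on integrable functions; integrability of
    each monomial times the power of the distribution function justifies exchanging the integral
    with both finite sums.\<close>
  have expand: "(LINT (x, y)|\<mu>. poly2 p x y * permuton_cdf \<mu> x y ^ k) =
      (\<Sum>b\<le>degree p. \<Sum>a\<le>degree (coeff p b). coeff (coeff p b) a * ?M \<mu> a b)"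
    if "permuton \<mu>" for \<mu>
  proof -
    note int = integrable_monomial_cdf[OF that]
    have "(LINT (x, y)|\<mu>. poly2 p x y * permuton_cdf \<mu> x y ^ k) =
        (\<integral>w. (\<Sum>b\<le>degree p. \<Sum>a\<le>degree (coeff p b). coeff (coeff p b) a *
          (fst w ^ a * permuton_cdf \<mu> (fst w) (snd w) ^ k * snd w ^ b)) \<partial>\<mu>)"
      unfolding case_prod_unfold poly2_eq_sum sum_distrib_right
      by (intro Bochner_Integration.integral_cong sum.cong refl) (simp only: ac_simps)
    also have "\<dots> = (\<Sum>b\<le>degree p. \<integral>w. (\<Sum>a\<le>degree (coeff p b). coeff (coeff p b) a *
        (fst w ^ a * permuton_cdf \<mu> (fst w) (snd w) ^ k * snd w ^ b)) \<partial>\<mu>)"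
      by (intro Bochner_Integration.integral_sum Bochner_Integration.integrable_sum
          integrable_mult_right int)
    also have "\<dots> = (\<Sum>b\<le>degree p. \<Sum>a\<le>degree (coeff p b). \<integral>w. coeff (coeff p b) a *
        (fst w ^ a * permuton_cdf \<mu> (fst w) (snd w) ^ k * snd w ^ b) \<partial>\<mu>)"
      by (intro sum.cong refl Bochner_Integration.integral_sum integrable_mult_right int)
    also have "\<dots> = (\<Sum>b\<le>degree p. \<Sum>a\<le>degree (coeff p b). coeff (coeff p b) a * ?M \<mu> a b)"
      by (intro sum.cong refl integral_mult_right_zero)
    finally show ?thesis .
  qed
  have "density_combination
      (\<lambda>\<mu>. \<Sum>b\<le>degree p. \<Sum>a\<le>degree (coeff p b). coeff (coeff p b) a * ?M \<mu> a b)"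
    by (intro density_combination_sum density_combination_cmult density_combination_monomial
        finite_atMost)
  then have "density_combination (\<lambda>\<mu>. LINT (x, y)|\<mu>. poly2 p x y * permuton_cdf \<mu> x y ^ k)"
    by (rule density_combination_cong) (rule expand)
  then show ?thesis
    unfolding density_combination_def .
qed

end
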